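(* Let $S$ be a densely defined symmetric operator in a complex Hilbert space $\mathcal{H}$, with closure $\overline{S}$, such that $0$ is a regular point of $\overline{S}$ (i.e. $\overline{S}$ is injective with bounded inverse on $\mathrm{ran}\,\overline{S}$) and such that the deficiency index satisfies $d(S)\geqslant 1$. Let $S_{\mathrm{D}}$ be the distinguished self-adjoint extension of $S$, with everywhere defined and bounded inverse. Let $\widetilde{S}$ be a self-adjoint extension of $S$ in $\mathcal{H}$. For arbitrary $\varepsilon>0$ let $U_\varepsilon:\ker(S^*-\mathrm{i}\varepsilon\mathbf{1})\to\ker(S^*+\mathrm{i}\varepsilon\mathbf{1})$ be the unitary von Neumann extension parameter of $\widetilde{S}$ at the spectral point $\mathrm{i}\varepsilon$, and let $T$ be the self-adjoint (Kreĭn–Višik–Birman) extension parameter of $\widetilde{S}$ relative to $S_{\mathrm{D}}$ (both defined in the context). Decompose an arbitrary $g\in\mathcal{D}(\widetilde{S})$ accordingly as $$f^{(g)}+S_{\mathrm{D}}^{-1}(Tu^{(g)}+w^{(g)})+u^{(g)}\;=\;g\;=\;f_\varepsilon^{(g)}+u_\varepsilon^{(g)}-U_\varepsilon u_\varepsilon^{(g)}$$ with $f^{(g)},f_\varepsilon^{(g)}\in\mathcal{D}(\overline{S})$, $u^{(g)}\in\mathcal{D}(T)$, $w^{(g)}\in\ker S^*\cap\mathcal{D}(T)^\perp$, $u_\varepsilon^{(g)}\in\ker(S^*-\mathrm{i}\varepsilon\mathbf{1})$, all uniquely determined by $g$ (and, where indicated, $\varepsilon$). Then $$\begin{aligned}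 u_\varepsilon^{(g)}&=(2\mathrm{i}\varepsilon)^{-1}P_{\ker(S^*-\mathrm{i}\varepsilon\mathbf{1})}(\widetilde{S}+\mathrm{i}\varepsilon\mathbf{1})g,\\ U_\varepsilon u_\varepsilon^{(g)}&=(2\mathrm{i}\varepsilon)^{-1}P_{\ker(S^*+\mathrm{i}\varepsilon\mathbf{1})}(\widetilde{S}-\mathrm{i}\varepsilon\mathbf{1})g,\\ u^{(g)}&=(\mathbf{1}-S_{\mathrm{D}}^{-1}\widetilde{S})g,\\ f^{(g)}&=S_{\mathrm{D}}^{-1}(\mathbf{1}-P_{\ker S^*})\widetilde{S}g,\\ Tu^{(g)}+w^{(g)}&=P_{\ker S^*}\widetilde{S}g, \end{aligned}$$ and moreover, for each fixed $g$, as $\varepsilon\downarrow 0$, $$\begin{aligned} (\mathbf{1}-S_{\mathrm{D}}^{-1}S^* )(u_\varepsilon^{(g)}-U_\varepsilon u_\varepsilon^{(g)})&=u^{(g)}+O(\varepsilon),\\ 2\mathrm{i}\varepsilon\,u_\varepsilon^{(g)}&=Tu^{(g)}+w^{(g)}+O(\varepsilon),\\ 2\mathrm{i}\varepsilon\,U_\varepsilon u_\varepsilon^{(g)}&=Tu^{(g)}+w^{(g)}+O(\varepsilon),\\ u_\varepsilon^{(g)}-U_\varepsilon u_\varepsilon^{(g)}&=S_{\mathrm{D}}^{-1}(Tu^{(g)}+w^{(g)})+u^{(g)}+O(\varepsilon),\\ \mathrm{i}\varepsilon\,u_\varepsilon^{(g)}+\mathrm{i}\varepsilon\,U_\varepsilon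 u_\varepsilon^{(g)}&=Tu^{(g)}+w^{(g)}+O(\varepsilon),\\ f_\varepsilon^{(g)}&=f^{(g)}+O(\varepsilon),\\ \overline{S}f_\varepsilon^{(g)}&=\overline{S}f^{(g)}+O(\varepsilon) \end{aligned}$$ in the norm of $\mathcal{H}$. In addition, $$u_\varepsilon^{(g)}-U_\varepsilon u_\varepsilon^{(g)}=S_{\mathrm{D}}^{-1}(Tu^{(g)}+w^{(g)})+u^{(g)}+O(\varepsilon),\qquad f_\varepsilon^{(g)}=f^{(g)}+O(\varepsilon)$$ in the graph norm of $\widetilde{S}$ (hence also in the graph norm of $S^*$).
   Context: Scalar products are linear in the second entry. $P_W$ denotes the orthogonal projection of $\mathcal{H}$ onto a closed subspace $W$. $\mathbf{1}$ is the identity operator. The graph norm of an operator $A$ is $\|h\|_{\Gamma(A)}=(\|h\|_{\mathcal{H}}^2+\|Ah\|_{\mathcal{H}}^2)^{1/2}$, $h\in\mathcal{D}(A)$. $O(\varepsilon)$ denotes a vector whose norm (in the indicated norm) is bounded by a constant, possibly depending on $g$, times $\varepsilon$. The deficiency index $d(S):=\dim\ker(S^*-z\mathbf{1})$ is, under the given assumptions, the same cardinal for all $z\in\mathbb{C}^+\cup\{0\}\cup\mathbb{C}^-$. It is a known fact (Calkin) that $S$ then has a self-adjoint extension with everywhere defined bounded inverse on $\mathcal{H}$; $S_{\mathrm{D}}$ denotes one such extension, fixed once and for all. Von Neumann parameter (known classification): for each $\varepsilon>0$ there is a unique unitary $U_\varepsilon:\ker(S^*-\mathrm{i}\varepsilon\mathbf{1})\to\ker(S^*+\mathrm{i}\varepsilon\mathbf{1})$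 (surjective isometry) such that $\mathcal{D}(\widetilde{S})=\mathcal{D}(\overline{S})\dotplus(\mathbf{1}-U_\varepsilon)\ker(S^*-\mathrm{i}\varepsilon\mathbf{1})$ and $\widetilde{S}(f+u-U_\varepsilon u)=\overline{S}f+\mathrm{i}\varepsilon u+\mathrm{i}\varepsilon U_\varepsilon u$ for $f\in\mathcal{D}(\overline{S})$, $u\in\ker(S^*-\mathrm{i}\varepsilon\mathbf{1})$. Kreĭn–Višik–Birman parameter (known classification): there is a unique operator $T$, self-adjoint in a closed subspace of $\ker S^*$ (namely in the Hilbert space $\overline{\mathcal{D}(T)}\subset\ker S^*$), such that $\mathcal{D}(\widetilde{S})=\{f+S_{\mathrm{D}}^{-1}(Tu+w)+u : f\in\mathcal{D}(\overline{S}),\,u\in\mathcal{D}(T),\,w\in\ker S^*\cap\mathcal{D}(T)^\perp\}$ and $\widetilde{S}(f+S_{\mathrm{D}}^{-1}(Tu+w)+u)=\overline{S}f+Tu+w$. The representation of each $g\in\mathcal{D}(\widetilde{S})$ in either form is unique. *)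

theory Defs
  imports "HOL-Analysis.Analysis" "HOL-Library.Landau_Symbols"
begin

unbundle cardinal_syntax

text \<open>Complex Hilbert spaces, with the scalar product linear in the second entry.\<close>

class complex_vector = real_vector +
  fixes scaleC :: "complex \<Rightarrow> 'a \<Rightarrow> 'a"  (infixr "*\<^sub>C" 75)
  assumes scaleC_add_right: "c *\<^sub>C (x + y) = c *\<^sub>C x + c *\<^sub>C y"
    and scaleC_add_left: "(b + c) *\<^sub>C x = b *\<^sub>C x + c *\<^sub>C x"
    and scaleC_scaleC: "b *\<^sub>C (c *\<^sub>C x) = (b * c) *\<^sub>C x"
    and scaleR_scaleC: "r *\<^sub>R x = complex_of_real r *\<^sub>C x"

class complex_inner = complex_vector + real_normed_vector +
  fixes cinner :: "'a \<Rightarrow> 'a \<Rightarrow> complex"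
  assumes cinner_commute: "cinner x y = cnj (cinner y x)"
    and cinner_add_right: "cinner x (y + z) = cinner x y + cinner x z"
    and cinner_scaleC_right: "cinner x (c *\<^sub>C y) = c * cinner x y"
    and cinner_self: "cinner x x = complex_of_real ((norm x)\<^sup>2)"

class chilbert_space = complex_inner + complete_space

instantiation complex :: chilbert_space
begin

definition scaleC_complex :: "complex \<Rightarrow> complex \<Rightarrow> complex"
  where "scaleC_complex c x = c * x"

definition cinner_complex :: "complex \<Rightarrow> complex \<Rightarrow> complex"
  where "cinner_complex x y = cnj x * y"

instance
  by standard
    (simp_all add: scaleC_complex_def cinner_complex_def algebra_simps scaleR_conv_of_real
      complex_norm_square del: of_real_power)

end

global_interpretation complex_vector: vector_space "scaleC :: complex \<Rightarrow> 'a \<Rightarrow> 'a::complex_vector"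
  defines csubspace = complex_vector.subspace
    and cspan = complex_vector.span
proof
  show "1 *\<^sub>C x = x" for x :: 'a
    using scaleR_scaleC[of 1 x] by simp
qed (simp_all add: scaleC_add_right scaleC_add_left scaleC_scaleC)

definition corth_compl :: "'a::complex_inner set \<Rightarrow> 'a set"
  where "corth_compl V = {x. \<forall>v\<in>V. cinner v x = 0}"

text \<open>The orthogonal projection onto \<open>W\<close>; meaningful for closed subspaces \<open>W\<close>.\<close>

definition orth_proj :: "'a::complex_inner set \<Rightarrow> 'a \<Rightarrow> 'a"
  where "orth_proj W h = (THE p. p \<in> W \<and> h - p \<in> corth_compl W)"

definition orthonormal_basis :: "'a::complex_inner set \<Rightarrow> 'a set \<Rightarrow> bool"
  where "orthonormal_basis W B \<longleftrightarrow>
    (\<forall>x\<in>B. norm x = 1) \<and> pairwise (\<lambda>x y. cinner x y = 0) B \<and> closure (cspan B) = W"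

text \<open>The Hilbert space dimension of a closed subspace, as a cardinal. All orthonormal bases
  have the same cardinality.\<close>

definition hilbert_dim :: "'a::complex_inner set \<Rightarrow> 'a rel"
  where "hilbert_dim W = |SOME B. orthonormal_basis W B|"

text \<open>A (partially defined, unbounded) operator is represented by its graph. Thus \<open>A \<subseteq> B\<close> means that
  \<open>B\<close> extends \<open>A\<close>, \<open>Domain A\<close> and \<open>Range A\<close> are domain and range, \<open>A\<inverse>\<close> is the graph of the inverse,
  and the operator closure is the topological \<open>closure A\<close> of the graph: the product norm
  on pairs is the graph norm.\<close>

type_synonym 'a operator = "('a \<times> 'a) set"

definition linear_operator :: "'a::complex_vector operator \<Rightarrow> bool"
  where "linear_operator A \<longleftrightarrow> single_valued A \<and> (0, 0) \<in> A \<and>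
    (\<forall>x y x' y'. (x, y) \<in> A \<and> (x', y') \<in> A \<longrightarrow> (x + x', y + y') \<in> A) \<and>
    (\<forall>c x y. (x, y) \<in> A \<longrightarrow> (c *\<^sub>C x, c *\<^sub>C y) \<in> A)"

text \<open>The value of \<open>A\<close> at \<open>x\<close>; unspecified unless \<open>x \<in> Domain A\<close> and \<open>A\<close> is single-valued.\<close>

definition app :: "'a operator \<Rightarrow> 'a \<Rightarrow> 'a"
  where "app A x = (THE y. (x, y) \<in> A)"

definition ker :: "'a::zero operator \<Rightarrow> 'a set"
  where "ker A = {x. (x, 0) \<in> A}"

text \<open>\<open>A - z \<one>\<close>\<close>

definition shift :: "'a::complex_vector operator \<Rightarrow> complex \<Rightarrow> 'a operator"
  where "shift A z = {(x, y - z *\<^sub>C x) | x y. (x, y) \<in> A}"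

definition bounded_operator :: "'a::real_normed_vector operator \<Rightarrow> bool"
  where "bounded_operator A \<longleftrightarrow> (\<exists>C. \<forall>(x, y)\<in>A. norm y \<le> C * norm x)"

definition graph_norm :: "'a::real_normed_vector operator \<Rightarrow> 'a \<Rightarrow> real"
  where "graph_norm A h = sqrt ((norm h)\<^sup>2 + (norm (app A h))\<^sup>2)"

definition densely_defined :: "'a::topological_space operator \<Rightarrow> bool"
  where "densely_defined A \<longleftrightarrow> closure (Domain A) = UNIV"

definition symmetric_operator :: "'a::complex_inner operator \<Rightarrow> bool"
  where "symmetric_operator A \<longleftrightarrow> linear_operator A \<and>
    (\<forall>(x, y)\<in>A. \<forall>(x', y')\<in>A. cinner x y' = cinner y x')"

text \<open>The adjoint of an operator \<open>A\<close> in the Hilbert space \<open>K\<close>, a closed subspace of the ambient one.\<close>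

definition op_adjoint_in :: "'a::complex_inner set \<Rightarrow> 'a operator \<Rightarrow> 'a operator"
  where "op_adjoint_in K A =
    {(x, y). x \<in> K \<and> y \<in> K \<and> (\<forall>(u, v)\<in>A. cinner x v = cinner y u)}"

definition self_adjoint_in :: "'a::complex_inner set \<Rightarrow> 'a operator \<Rightarrow> bool"
  where "self_adjoint_in K A \<longleftrightarrow>
    linear_operator A \<and> A \<subseteq> K \<times> K \<and> closure (Domain A) = K \<and> op_adjoint_in K A = A"

abbreviation op_adjoint :: "'a::complex_inner operator \<Rightarrow> 'a operator"
  where "op_adjoint \<equiv> op_adjoint_in UNIV"

abbreviation self_adjoint :: "'a::complex_inner operator \<Rightarrow> bool"
  where "self_adjoint \<equiv> self_adjoint_in UNIV"

definition regular_point :: "'a::complex_inner operator \<Rightarrow> complex \<Rightarrow> bool"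
  where "regular_point A z \<longleftrightarrow> single_valued ((shift A z)\<inverse>) \<and> bounded_operator ((shift A z)\<inverse>)"

text \<open>The deficiency index computed at the point \<open>z\<close>. For a densely defined symmetric operator
  with regular point \<open>0\<close> of its closure, it is the same cardinal for
  all \<open>z\<close> that are \<open>0\<close> or non-real.\<close>

definition deficiency_index :: "'a::complex_inner operator \<Rightarrow> complex \<Rightarrow> 'a rel"
  where "deficiency_index S z = hilbert_dim (ker (shift (op_adjoint S) z))"

definition distinguished_extension :: "'a::complex_inner operator \<Rightarrow> 'a operator \<Rightarrow> bool"
  where "distinguished_extension S SD \<longleftrightarrow> self_adjoint SD \<and> S \<subseteq> SD \<and>
    single_valued (SD\<inverse>) \<and> Domain (SD\<inverse>) = UNIV \<and> bounded_operator (SD\<inverse>)"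

definition unitary_between :: "'a::complex_inner set \<Rightarrow> 'a set \<Rightarrow> ('a \<Rightarrow> 'a) \<Rightarrow> bool"
  where "unitary_between V W U \<longleftrightarrow>
    (\<forall>x\<in>V. \<forall>y\<in>V. U (x + y) = U x + U y) \<and> (\<forall>c. \<forall>x\<in>V. U (c *\<^sub>C x) = c *\<^sub>C U x) \<and>
    (\<forall>x\<in>V. norm (U x) = norm x) \<and> U ` V = W"

definition direct_sum :: "'a::ab_group_add set \<Rightarrow> 'a set \<Rightarrow> 'a set \<Rightarrow> bool"
  where "direct_sum D V W \<longleftrightarrow> D = {v + w | v w. v \<in> V \<and> w \<in> W} \<and> V \<inter> W = {0}"

text \<open>\<open>U\<close> is the von Neumann parameter of the self-adjoint extension \<open>St\<close> of \<open>S\<close>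
  at the spectral point \<open>\<i>\<epsilon>\<close>.\<close>

definition von_neumann_parameter ::
    "'a::complex_inner operator \<Rightarrow> 'a operator \<Rightarrow> real \<Rightarrow> ('a \<Rightarrow> 'a) \<Rightarrow> bool"
  where "von_neumann_parameter S St \<epsilon> U \<longleftrightarrow>
    (let N = ker (shift (op_adjoint S) (\<i> * of_real \<epsilon>));
         N' = ker (shift (op_adjoint S) (- \<i> * of_real \<epsilon>))
     in unitary_between N N' U \<and>
        direct_sum (Domain St) (Domain (closure S)) ((\<lambda>u. u - U u) ` N) \<and>
        (\<forall>f\<in>Domain (closure S). \<forall>u\<in>N.
          app St (f + u - U u) =
            app (closure S) f + (\<i> * of_real \<epsilon>) *\<^sub>C u + (\<i> * of_real \<epsilon>) *\<^sub>C U u))"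

text \<open>\<open>T\<close> is the Krein-Visik-Birman parameter of the self-adjoint extension \<open>St\<close> of \<open>S\<close> relative to
  \<open>SD\<close>. It is densely defined only in the closed subspace \<open>closure (Domain T)\<close> of \<open>ker S\<^sup>*\<close>.\<close>

definition kvb_parameter ::
    "'a::complex_inner operator \<Rightarrow> 'a operator \<Rightarrow> 'a operator \<Rightarrow> 'a operator \<Rightarrow> bool"
  where "kvb_parameter S SD St T \<longleftrightarrow>
    (let K = ker (op_adjoint S);
         W = K \<inter> corth_compl (Domain T)
     in closure (Domain T) \<subseteq> K \<and> self_adjoint_in (closure (Domain T)) T \<and>
        Domain St = {f + app (SD\<inverse>) (app T u + w) + u | f u w.
          f \<in> Domain (closure S) \<and> u \<in> Domain T \<and> w \<in> W} \<and>
        (\<forall>f\<in>Domain (closure S). \<forall>u\<in>Domain T. \<forall>w\<in>W.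
          app St (f + app (SD\<inverse>) (app T u + w) + u) = app (closure S) f + app T u + w))"

text \<open>\<open>a \<epsilon> = b + O(\<epsilon>)\<close> as \<open>\<epsilon> \<down> 0\<close>, in the norm of the Hilbert space and in the graph norm of \<open>A\<close>.
  The latter includes that the remainder lies in the domain of \<open>A\<close>.\<close>

definition eq_upto_O :: "(real \<Rightarrow> 'a::real_normed_vector) \<Rightarrow> 'a \<Rightarrow> bool"
  where "eq_upto_O a b \<longleftrightarrow> (\<lambda>\<epsilon>. norm (a \<epsilon> - b)) \<in> O[at_right 0](\<lambda>\<epsilon>. \<epsilon>)"

definition eq_upto_O_graph ::
    "'a::real_normed_vector operator \<Rightarrow> (real \<Rightarrow> 'a) \<Rightarrow> 'a \<Rightarrow> bool"
  where "eq_upto_O_graph A a b \<longleftrightarrow> (\<forall>\<epsilon>>0. a \<epsilon> - b \<in> Domain A) \<and>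
    (\<lambda>\<epsilon>. graph_norm A (a \<epsilon> - b)) \<in> O[at_right 0](\<lambda>\<epsilon>. \<epsilon>)"

end

theory Submission
  imports Defs
begin

text \<open>With \<open>h = St g\<close> and \<open>k = T u + w\<close>, the two action formulas of \<open>St\<close> give
  \<open>h \<plusminus> \<i>\<epsilon> g = (S\<^sup>- \<plusminus> \<i>\<epsilon>) f\<^sub>\<epsilon> + v\<^sub>\<plusminus>\<close> with \<open>v\<^sub>+ = 2\<i>\<epsilon> u\<^sub>\<epsilon>\<close>, \<open>v\<^sub>- = 2\<i>\<epsilon> U\<^sub>\<epsilon> u\<^sub>\<epsilon>\<close>, and
  \<open>h = S\<^sup>- f + k\<close> (where \<open>S\<^sup>-\<close> is the closure of \<open>S\<close>). These are orthogonal decompositions, because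
  \<open>ran (S\<^sup>- - cnj z)\<close> is orthogonal to \<open>ker (S\<^sup>* - z)\<close>; this yields the exact formulas.
  For the asymptotics, \<open>v' = v\<^sub>+ - \<i>\<epsilon> SD\<inverse> v\<^sub>+\<close> lies in \<open>ker S\<^sup>*\<close>, and subtracting the
  decompositions at \<open>\<epsilon>\<close> and at \<open>0\<close> gives
  \<open>S\<^sup>- (f - f\<^sub>\<epsilon>) + (k - v') = \<i>\<epsilon> (SD\<inverse> v\<^sub>+ + f\<^sub>\<epsilon> - g)\<close>.
  The two summands on the left are orthogonal and the right-hand side is \<open>O(\<epsilon>)\<close>, so both
  summands are \<open>O(\<epsilon>)\<close>; every other estimate follows by boundedness of \<open>SD\<inverse>\<close>.\<close>

section \<open>Complex inner products\<close>

lemma cinner_add_left: "cinner (x + y) z = cinner x z + cinner y (z::'a::complex_inner)"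
  by (metis cinner_commute cinner_add_right complex_cnj_add)

lemma cinner_scaleC_left: "cinner (c *\<^sub>C x) y = cnj c * cinner x (y::'a::complex_inner)"
  by (metis cinner_commute cinner_scaleC_right complex_cnj_mult)

lemma cinner_simps [simp]:
  fixes x :: "'a::complex_inner"
  shows "cinner x 0 = 0" "cinner 0 x = 0"
    "cinner x (- y) = - cinner x y" "cinner (- x) y = - cinner x y"
  using cinner_scaleC_right[of x 0 0] cinner_scaleC_left[of 0 0 x]
    cinner_scaleC_right[of x "-1" y] cinner_scaleC_left[of "-1" x y] by simp_all

lemma cinner_diff_right: "cinner x (y - z) = cinner x y - cinner x (z::'a::complex_inner)"
  using cinner_add_right[of x y "- z"] by simp

lemma cinner_diff_left: "cinner (x - y) z = cinner x z - cinner y (z::'a::complex_inner)"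
  using cinner_add_left[of x "- y" z] by simp

text \<open>The class provides homogeneity of the norm for real scalars only; the complex case is
  recovered from the scalar product of \<open>c *\<^sub>C x\<close> with itself.\<close>

lemma norm_scaleC: "norm (c *\<^sub>C x) = cmod c * norm (x::'a::complex_inner)"
proof -
  have "complex_of_real ((norm (c *\<^sub>C x))\<^sup>2) = c * cnj c * complex_of_real ((norm x)\<^sup>2)"
    by (simp add: cinner_self[symmetric] cinner_scaleC_left cinner_scaleC_right del: of_real_power)
  also have "\<dots> = complex_of_real ((cmod c * norm x)\<^sup>2)"
    by (simp add: complex_norm_square[symmetric] power_mult_distrib)
  finally have "(norm (c *\<^sub>C x))\<^sup>2 = (cmod c * norm x)\<^sup>2"
    by (simp only: of_real_eq_iff)
  then show ?thesis by (simp only: power2_eq_iff_nonneg norm_ge_zero mult_nonneg_nonneg)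
qed

lemma norm_add_square:
  "(norm (x + y))\<^sup>2 = (norm x)\<^sup>2 + (norm y)\<^sup>2 + 2 * Re (cinner x (y::'a::complex_inner))"
proof -
  have "Re (cinner y x) = Re (cinner x y)"
    using cinner_commute[of y x] by simp
  moreover have "(norm z)\<^sup>2 = Re (cinner z z)" for z :: 'a
    by (simp add: cinner_self del: of_real_power)
  ultimately show ?thesis
    by (simp add: cinner_add_left cinner_add_right)
qed

text \<open>Pythagoras, since the cross term vanishes. A bound on an orthogonal sum thereby passes
  to each summand.\<close>

lemma norm_le_add_orthogonal:
  assumes "cinner x (y::'a::complex_inner) = 0"
  shows "norm x \<le> norm (x + y)" "norm y \<le> norm (x + y)"
proof -
  have "(norm x)\<^sup>2 \<le> (norm (x + y))\<^sup>2" "(norm y)\<^sup>2 \<le> (norm (x + y))\<^sup>2"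
    using assms by (simp_all add: norm_add_square)
  then show "norm x \<le> norm (x + y)" "norm y \<le> norm (x + y)"
    by (blast intro: power2_le_imp_le[OF _ norm_ge_zero])+
qed

lemma tendsto_scaleC_right:
  assumes "(X \<longlongrightarrow> l) F"
  shows "((\<lambda>n. c *\<^sub>C X n) \<longlongrightarrow> c *\<^sub>C (l::'a::complex_inner)) F"
proof -
  have "((\<lambda>n. cmod c * norm (X n - l)) \<longlongrightarrow> cmod c * 0) F"
    using assms by (intro tendsto_mult_left tendsto_norm_zero LIM_zero)
  then have "((\<lambda>n. norm (c *\<^sub>C X n - c *\<^sub>C l)) \<longlongrightarrow> 0) F"
    by (simp only: norm_scaleC complex_vector.scale_right_diff_distrib[symmetric] mult_zero_right)
  then show ?thesis by (rule LIM_zero_cancel[OF tendsto_norm_zero_cancel])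
qed

text \<open>The polarization identity reduces continuity of the inner product to that of the norm.\<close>

lemma tendsto_cinner_right:
  assumes "(Y \<longlongrightarrow> y) F"
  shows "((\<lambda>n. cinner x (Y n)) \<longlongrightarrow> cinner x (y::'a::complex_inner)) F"
proof -
  have re: "((\<lambda>n. Re (cinner x (Z n))) \<longlongrightarrow> Re (cinner x z)) F" if "(Z \<longlongrightarrow> z) F" for Z z
  proof -
    have "Re (cinner x z) = ((norm (x + z))\<^sup>2 - (norm x)\<^sup>2 - (norm z)\<^sup>2) / 2" for z
      by (simp add: norm_add_square)
    then show ?thesis
      by (simp only:) (auto intro!: tendsto_intros that)
  qed
  \<comment> \<open>The imaginary part of \<open>cinner x y\<close> is minus the real part of
    \<open>cinner x (\<i> *\<^sub>C y)\<close>, so the real case applies again.\<close>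
  have "((\<lambda>n. Im (cinner x (Y n))) \<longlongrightarrow> Im (cinner x y)) F"
    using tendsto_minus[OF re[OF tendsto_scaleC_right[OF assms, of \<i>]]]
    by (simp add: cinner_scaleC_right)
  with re[OF assms] show ?thesis by (simp only: tendsto_complex_iff)
qed

lemma tendsto_cinner_left:
  assumes "(Y \<longlongrightarrow> y) F"
  shows "((\<lambda>n. cinner (Y n) x) \<longlongrightarrow> cinner y (x::'a::complex_inner)) F"
proof -
  have "((\<lambda>n. cnj (cinner x (Y n))) \<longlongrightarrow> cnj (cinner x y)) F"
    using assms by (intro tendsto_cnj tendsto_cinner_right)
  then show ?thesis by (simp only: cinner_commute[symmetric])
qed

text \<open>The difference of two candidates lies in \<open>W\<close> and is orthogonal to
  \<open>W\<close>, hence is zero. Projections are thus computed by exhibiting a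
  decomposition.\<close>

lemma orth_proj_eqI:
  assumes "csubspace W" "p \<in> W" "h - p \<in> corth_compl W"
  shows "orth_proj W (h::'a::complex_inner) = p"
  unfolding orth_proj_def
proof (rule the_equality)
  fix q assume q: "q \<in> W \<and> h - q \<in> corth_compl W"
  then have "q - p \<in> W" using assms complex_vector.subspace_diff by blast
  then have "cinner (q - p) (h - p) = 0" "cinner (q - p) (h - q) = 0"
    using q assms(3) by (auto simp: corth_compl_def)
  moreover have "cinner (q - p) (q - p) = cinner (q - p) (h - p) - cinner (q - p) (h - q)"
    by (simp add: cinner_diff_right)
  ultimately have "cinner (q - p) (q - p) = 0" by simp
  then show "q = p" by (simp add: cinner_self)
qed (use assms in auto)

section \<open>Operators and adjoints\<close>

lemma app_eqI: "single_valued A \<Longrightarrow> (x, y) \<in> A \<Longrightarrow> app A x = y"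
  unfolding app_def by (rule the_equality) (auto dest: single_valuedD)

lemma app_in: "single_valued A \<Longrightarrow> x \<in> Domain A \<Longrightarrow> (x, app A x) \<in> A"
  using app_eqI by fastforce

lemma linear_operator_add:
  "linear_operator A \<Longrightarrow> (x, y) \<in> A \<Longrightarrow> (x', y') \<in> A \<Longrightarrow> (x + x', y + y') \<in> A"
  by (simp add: linear_operator_def)

lemma linear_operator_scaleC:
  "linear_operator A \<Longrightarrow> (x, y) \<in> A \<Longrightarrow> (c *\<^sub>C x, c *\<^sub>C y) \<in> A"
  by (simp add: linear_operator_def)

lemma linear_operator_diff:
  assumes "linear_operator A" "(x, y) \<in> A" "(x', y') \<in> A"
  shows "(x - x', y - y') \<in> A"
  using linear_operator_add[OF assms(1,2) linear_operator_scaleC[OF assms(1,3), of "-1"]] by simp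

lemma in_op_adjoint:
  "(x, y) \<in> op_adjoint A \<longleftrightarrow> (\<forall>u v. (u, v) \<in> A \<longrightarrow> cinner x v = cinner y u)"
  by (auto simp: op_adjoint_in_def)

lemma op_adjoint_antimono: "A \<subseteq> B \<Longrightarrow> op_adjoint B \<subseteq> op_adjoint A"
  by (force simp: op_adjoint_in_def)

lemma subset_op_adjoint_op_adjoint: "A \<subseteq> op_adjoint (op_adjoint A)"
proof
  fix p assume "p \<in> A"
  then obtain a b where ab: "p = (a, b)" "(a, b) \<in> A" by (cases p) auto
  have "cinner a v = cinner b u" if "(u, v) \<in> op_adjoint A" for u v
    using that ab cinner_commute[of a v] cinner_commute[of b u] by (simp only: in_op_adjoint)
  then show "p \<in> op_adjoint (op_adjoint A)" using ab by (simp add: in_op_adjoint)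
qed

text \<open>The defining equation of the adjoint passes to limits of pairs. It follows that
  \<open>closure S\<close> lies in the double adjoint of \<open>S\<close> and in every self-adjoint
  extension, since the latter is its own adjoint.\<close>

lemma closed_op_adjoint: "closed (op_adjoint (A :: 'a::complex_inner operator))"
  unfolding closed_sequential_limits
proof safe
  fix X :: "nat \<Rightarrow> 'a \<times> 'a" and x y
  assume X: "\<forall>n. X n \<in> op_adjoint A" and lim: "X \<longlonglongrightarrow> (x, y)"
  show "(x, y) \<in> op_adjoint A"
    unfolding in_op_adjoint
  proof (intro allI impI)
    fix u v assume uv: "(u, v) \<in> A"
    have "cinner (fst (X n)) v = cinner (snd (X n)) u" for n
      using X uv by (metis in_op_adjoint prod.collapse)
    moreover have "(\<lambda>n. cinner (fst (X n)) v) \<longlonglongrightarrow> cinner x v"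
      "(\<lambda>n. cinner (snd (X n)) u) \<longlonglongrightarrow> cinner y u"
      using tendsto_fst[OF lim] tendsto_snd[OF lim] by (auto intro: tendsto_cinner_left)
    ultimately show "cinner x v = cinner y u"
      by (simp add: LIMSEQ_unique)
  qed
qed

text \<open>If \<open>(0, y)\<close> belongs to the adjoint, then \<open>y\<close> is orthogonal to
  a dense domain and so to itself; this is what makes the adjoint single-valued.\<close>

lemma linear_op_adjoint:
  fixes A :: "'a::complex_inner operator"
  assumes "densely_defined A"
  shows "linear_operator (op_adjoint A)"
proof -
  have zero: "y = 0" if "(0, y) \<in> op_adjoint A" for y
  proof -
    obtain X where X: "\<And>n. X n \<in> Domain A" "X \<longlonglongrightarrow> y"
      using assms unfolding densely_defined_def by (metis UNIV_I closure_sequential)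
    then have "cinner y (X n) = 0" for n
      using that by (metis DomainE cinner_simps(2) in_op_adjoint)
    then have "cinner y y = 0"
      using tendsto_cinner_right[OF X(2), of y] by (simp add: LIMSEQ_const_iff)
    then show ?thesis by (simp add: cinner_self)
  qed
  have "y = y'" if "(x, y) \<in> op_adjoint A" "(x, y') \<in> op_adjoint A" for x y y'
    using zero[of "y - y'"] that by (simp add: in_op_adjoint cinner_diff_left)
  then show ?thesis
    unfolding linear_operator_def
    by (auto simp: in_op_adjoint cinner_add_left cinner_scaleC_left intro: single_valuedI)
qed

lemma mem_ker_shift: "x \<in> ker (shift A z) \<longleftrightarrow> (x, z *\<^sub>C x) \<in> A"
  by (auto simp: ker_def shift_def)

lemma csubspace_ker: "linear_operator A \<Longrightarrow> csubspace (ker A)"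
  unfolding complex_vector.subspace_def ker_def
  using linear_operator_add[of A _ 0 _ 0] linear_operator_scaleC[of A _ 0]
  by (auto simp: linear_operator_def)

lemma linear_operator_shift:
  assumes "linear_operator A" shows "linear_operator (shift A z)"
  unfolding linear_operator_def
proof (intro conjI allI impI)
  show "single_valued (shift A z)"
    using assms by (auto simp: linear_operator_def shift_def single_valued_def)
  show "(0, 0) \<in> shift A z"
    using assms by (force simp: linear_operator_def shift_def)
next
  fix x y x' y' assume "(x, y) \<in> shift A z \<and> (x', y') \<in> shift A z"
  then obtain a b where "(x, a) \<in> A" "(x', b) \<in> A" "y = a - z *\<^sub>C x" "y' = b - z *\<^sub>C x'"
    by (auto simp: shift_def)
  then show "(x + x', y + y') \<in> shift A z"
    unfolding shift_def using linear_operator_add[OF assms]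
    by (auto simp: scaleC_add_right intro!: exI[of _ "a + b"])
next
  fix c x y assume "(x, y) \<in> shift A z"
  then obtain a where "(x, a) \<in> A" "y = a - z *\<^sub>C x"
    by (auto simp: shift_def)
  then show "(c *\<^sub>C x, c *\<^sub>C y) \<in> shift A z"
    unfolding shift_def using linear_operator_scaleC[OF assms]
    by (auto simp: complex_vector.scale_right_diff_distrib mult.commute intro!: exI[of _ "c *\<^sub>C a"])
qed

text \<open>Conjugate linearity in the first entry turns the eigenvalue \<open>z\<close> into
  \<open>cnj z\<close>. The pair \<open>(x, y)\<close> is taken from the double adjoint because that
  contains \<open>closure S\<close>.\<close>

lemma ker_shift_orthogonal:
  assumes "(x, y) \<in> op_adjoint (op_adjoint S)" and "(v, z *\<^sub>C v) \<in> op_adjoint S"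
  shows "cinner v (y - cnj z *\<^sub>C x) = 0"
proof -
  have "cinner x (z *\<^sub>C v) = cinner y v"
    using assms by (simp add: in_op_adjoint)
  then have "cinner (z *\<^sub>C v) x = cinner v y"
    using cinner_commute[of "z *\<^sub>C v" x] cinner_commute[of v y] by (simp only:)
  then show ?thesis by (simp add: cinner_diff_right cinner_scaleC_right cinner_scaleC_left)
qed

text \<open>The symmetry condition makes \<open>cinner y x\<close> real, so the cross term with the
  imaginary multiple of \<open>x\<close> has real part zero.\<close>

lemma norm_le_norm_add_imaginary:
  assumes "cinner x y = cinner y (x::'a::complex_inner)"
  shows "norm y \<le> norm (y + (\<i> * of_real e) *\<^sub>C x)"
proof -
  have "cnj (cinner y x) = cinner y x"
    using assms cinner_commute by metis
  then have "Im (cinner y x) = 0"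
    by (simp add: complex_eq_iff)
  then have "Re (cinner y ((\<i> * of_real e) *\<^sub>C x)) = 0"
    by (simp add: cinner_scaleC_right)
  then have "(norm y)\<^sup>2 \<le> (norm (y + (\<i> * of_real e) *\<^sub>C x))\<^sup>2"
    by (simp add: norm_add_square)
  then show ?thesis by (rule power2_le_imp_le[OF _ norm_ge_zero])
qed

section \<open>The estimate as \<open>\<epsilon> \<down> 0\<close>\<close>

text \<open>Explicit bounds on the interval up to \<open>1\<close> suffice, since the filter sees
  only small positive \<open>e\<close>.\<close>

lemma eq_upto_OI:
  assumes "\<And>e. 0 < e \<Longrightarrow> e \<le> 1 \<Longrightarrow> norm (a e - b) \<le> M * e"
  shows "eq_upto_O a b"
  unfolding eq_upto_O_def
proof (rule bigoI[of _ M])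
  have "eventually (\<lambda>e. e \<in> {0<..<1::real}) (at_right 0)"
    by (rule eventually_at_right_real) simp
  then show "\<forall>\<^sub>F e in at_right 0. norm (norm (a e - b)) \<le> M * norm (e::real)"
    by eventually_elim (use assms in auto)
qed

lemma eq_upto_O_graphI:
  assumes "single_valued A" and "\<And>e. 0 < e \<Longrightarrow> (a e - b, y e) \<in> A"
    and "\<And>e. 0 < e \<Longrightarrow> e \<le> 1 \<Longrightarrow> norm (a e - b) \<le> M * e"
    and "\<And>e. 0 < e \<Longrightarrow> e \<le> 1 \<Longrightarrow> norm (y e) \<le> M' * e"
  shows "eq_upto_O_graph A a b"
  unfolding eq_upto_O_graph_def
proof
  show "\<forall>e>0. a e - b \<in> Domain A" using assms(2) by blast
  have le: "\<bar>graph_norm A (a e - b)\<bar> \<le> (M + M') * e" if "0 < e" "e \<le> 1" for e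
  proof -
    have "graph_norm A (a e - b) \<le> norm (a e - b) + norm (y e)"
      using app_eqI[OF assms(1,2)] that by (simp add: graph_norm_def sqrt_sum_squares_le_sum)
    moreover have "0 \<le> graph_norm A (a e - b)" by (simp add: graph_norm_def)
    ultimately show ?thesis
      using assms(3,4)[OF that] by (simp add: algebra_simps)
  qed
  show "(\<lambda>e. graph_norm A (a e - b)) \<in> O[at_right 0](\<lambda>e. e)"
  proof (rule bigoI[of _ "M + M'"])
    have "eventually (\<lambda>e. e \<in> {0<..<1::real}) (at_right 0)"
      by (rule eventually_at_right_real) simp
    then show "\<forall>\<^sub>F e in at_right 0. norm (graph_norm A (a e - b)) \<le> (M + M') * norm (e::real)"
      by eventually_elim (use le in auto)
  qed
qed

text \<open>This compares the decompositions at \<open>0\<close> and at \<open>e\<close>: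
  \<open>R\<close> is the inverse of \<open>SD\<close> with bound \<open>C\<close>, \<open>y\<close>
  and \<open>y'\<close> are the images of \<open>f\<close> and \<open>f'\<close>, and
  \<open>v\<close> stands for \<open>2 \<i> e\<close> times the von Neumann component. The constants
  are built from \<open>C\<close>, \<open>h\<close> and \<open>g\<close> alone, hence are uniform in
  \<open>e\<close>.\<close>

lemma deficiency_estimate:
  fixes S SD :: "'a::complex_inner operator"
  assumes S: "densely_defined S" "S \<subseteq> SD"
    and SD: "self_adjoint SD" "\<And>y. (R y, y) \<in> SD" "\<And>x y. (x, y) \<in> SD \<Longrightarrow> norm x \<le> C * norm y"
    and C: "0 \<le> C"
    and f: "(f, y) \<in> closure S" "(f', y') \<in> closure S"
    and k: "(k, 0) \<in> op_adjoint S"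
    and v: "(v, (\<i> * of_real e) *\<^sub>C v) \<in> op_adjoint S"
    and h0: "h = y + k"
    and h1: "h + (\<i> * of_real e) *\<^sub>C g = y' + (\<i> * of_real e) *\<^sub>C f' + v"
    and e: "0 < e" "e \<le> 1"
  defines "B \<equiv> norm h + norm g"
  defines "M \<equiv> C * B + C * B + norm g"
  shows "norm (y - y') \<le> M * e" and "norm (f - f') \<le> C * M * e" and "norm (k - v) \<le> (M + C * B) * e"
proof -
  let ?z = "\<i> * complex_of_real e"
  have adj: "op_adjoint SD = SD" and lin: "linear_operator SD"
    using SD(1) by (auto simp: self_adjoint_in_def)
  have clSD: "closure S \<subseteq> SD"
    using S(2) closed_op_adjoint[of SD] adj by (simp add: closure_minimal)
  have clS: "closure S \<subseteq> op_adjoint (op_adjoint S)"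
    by (simp add: closed_op_adjoint closure_minimal subset_op_adjoint_op_adjoint)
  have SDS: "SD \<subseteq> op_adjoint S"
    using op_adjoint_antimono[OF S(2)] adj by simp
  have linS: "linear_operator (op_adjoint S)" using S(1) by (rule linear_op_adjoint)
  have fSD: "(f, y) \<in> SD" "(f', y') \<in> SD" using f clSD by auto
  \<comment> \<open>For \<open>z = ?z\<close> one has \<open>cnj z = - ?z\<close>, which produces
    the plus sign.\<close>
  have orth: "cinner v (y' + ?z *\<^sub>C f') = 0"
    using ker_shift_orthogonal[of f' y' S v ?z] f(2) clS v by auto
  \<comment> \<open>Here \<open>e \<le> 1\<close> makes the bound \<open>B\<close> independent of
    \<open>e\<close>.\<close>
  have bound: "norm (h + ?z *\<^sub>C g) \<le> B"
    using norm_triangle_ineq[of h "?z *\<^sub>C g"] mult_right_mono[OF e(2), of "norm g"] e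
    by (simp add: B_def norm_scaleC norm_mult)
  have vB: "norm v \<le> B" and yB: "norm (y' + ?z *\<^sub>C f') \<le> B"
    using norm_le_add_orthogonal[OF orth] bound h1 by (auto simp: add.commute)
  \<comment> \<open>Symmetry of \<open>SD\<close> allows the imaginary multiple of \<open>f'\<close>
    to be dropped, so \<open>y'\<close> alone is bounded by \<open>B\<close>.\<close>
  have "cinner f' y' = cinner y' f'"
    using fSD(2) adj in_op_adjoint by blast
  then have "norm y' \<le> B"
    using norm_le_norm_add_imaginary yB order_trans by blast
  then have f'B: "norm f' \<le> C * B"
    using SD(3)[OF fSD(2)] C mult_left_mono order_trans by blast
  have RvB: "norm (R v) \<le> C * B"
    using SD(3)[OF SD(2)] C mult_left_mono[OF vB C] order_trans by blast
  \<comment> \<open>The adjoint of \<open>S\<close> extends \<open>SD\<close>, so it sends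
    \<open>?z *\<^sub>C R v\<close> to \<open>?z *\<^sub>C v\<close>, which is also its value at
    \<open>v\<close>. The correction therefore moves \<open>v\<close> into the kernel at
    \<open>0\<close>.\<close>
  define v' where "v' = v - ?z *\<^sub>C R v"
  have "(v', ?z *\<^sub>C v - ?z *\<^sub>C v) \<in> op_adjoint S"
    unfolding v'_def using SDS SD(2)
    by (intro linear_operator_diff[OF linS v] linear_operator_scaleC[OF linS]) auto
  with k have kv: "(k - v', 0) \<in> op_adjoint S"
    using linear_operator_diff[OF linS k] by fastforce
  have "cinner (k - v') y = 0" "cinner (k - v') y' = 0"
    using ker_shift_orthogonal[of f y S "k - v'" 0] ker_shift_orthogonal[of f' y' S "k - v'" 0]
      f clS kv by auto
  then have orth': "cinner (k - v') (y - y') = 0" by (simp add: cinner_diff_right)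
  have "y + k + ?z *\<^sub>C g = y' + ?z *\<^sub>C f' + v" using h0 h1 by simp
  then have eq: "(k - v') + (y - y') = ?z *\<^sub>C (R v + f' - g)"
    unfolding v'_def scaleC_add_right complex_vector.scale_right_diff_distrib
    by (simp add: algebra_simps)
  \<comment> \<open>The three summands of \<open>M\<close> bound \<open>R v\<close>,
    \<open>f'\<close> and \<open>g\<close> in this order; the factor \<open>e\<close> will come from
    the scalar \<open>?z\<close>.\<close>
  have "norm (R v + f' - g) \<le> norm (R v) + norm f' + norm g"
    using norm_triangle_ineq4[of "R v + f'" g] norm_triangle_ineq[of "R v" f'] by linarith
  then have rM: "norm (R v + f' - g) \<le> M"
    using RvB f'B unfolding M_def by linarith
  then have rem: "norm (?z *\<^sub>C (R v + f' - g)) \<le> M * e"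
    using e mult_left_mono[OF rM, of e] by (simp add: norm_scaleC norm_mult mult.commute)
  show yM: "norm (y - y') \<le> M * e"
    using norm_le_add_orthogonal(2)[OF orth'] rem eq by simp
  \<comment> \<open>\<open>SD\<close> sends \<open>f - f'\<close> to \<open>y - y'\<close>, so
    inverting it costs the factor \<open>C\<close>.\<close>
  show "norm (f - f') \<le> C * M * e"
    using SD(3)[OF linear_operator_diff[OF lin fSD]] mult_left_mono[OF yM C] by simp
  have "norm (k - v') \<le> M * e"
    using norm_le_add_orthogonal(1)[OF orth'] rem eq by simp
  \<comment> \<open>Returning from \<open>v'\<close> to \<open>v\<close> costs this term, the source
    of the extra \<open>C * B\<close>.\<close>
  moreover have "norm (?z *\<^sub>C R v) \<le> C * B * e"
    using e mult_left_mono[OF RvB, of e] by (simp add: norm_scaleC norm_mult mult.commute)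
  moreover have "k - v = (k - v') - ?z *\<^sub>C R v" by (simp add: v'_def)
  ultimately show "norm (k - v) \<le> (M + C * B) * e"
    using norm_triangle_ineq4[of "k - v'" "?z *\<^sub>C R v"] by (simp add: algebra_simps)
qed

theorem theorem3p1:
  fixes S SD St T :: "'a::chilbert_space operator"
    and z :: complex
    and U :: "real \<Rightarrow> 'a \<Rightarrow> 'a"
    and g f u w :: 'a
    and f\<^sub>\<epsilon> u\<^sub>\<epsilon> :: "real \<Rightarrow> 'a"
  assumes "densely_defined S" and "symmetric_operator S"
    and "regular_point (closure S) 0"
    and "z = 0 \<or> Im z \<noteq> 0" and "|{()}| \<le>o deficiency_index S z"
    and "distinguished_extension S SD"
    and "self_adjoint St" and "S \<subseteq> St"
    and "\<forall>\<epsilon>>0. von_neumann_parameter S St \<epsilon> (U \<epsilon>)"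
    and "kvb_parameter S SD St T"
    and "g \<in> Domain St"
    and "f \<in> Domain (closure S)" and "u \<in> Domain T"
    and "w \<in> ker (op_adjoint S) \<inter> corth_compl (Domain T)"
    and "g = f + app (SD\<inverse>) (app T u + w) + u"
    and "\<forall>\<epsilon>>0. f\<^sub>\<epsilon> \<epsilon> \<in> Domain (closure S)"
    and "\<forall>\<epsilon>>0. u\<^sub>\<epsilon> \<epsilon> \<in> ker (shift (op_adjoint S) (\<i> * of_real \<epsilon>))"
    and "\<forall>\<epsilon>>0. g = f\<^sub>\<epsilon> \<epsilon> + u\<^sub>\<epsilon> \<epsilon> - U \<epsilon> (u\<^sub>\<epsilon> \<epsilon>)"
  shows "
    (\<forall>\<epsilon>>0. u\<^sub>\<epsilon> \<epsilon> = inverse (2 * \<i> * of_real \<epsilon>) *\<^sub>C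
      orth_proj (ker (shift (op_adjoint S) (\<i> * of_real \<epsilon>))) (app St g + (\<i> * of_real \<epsilon>) *\<^sub>C g)) \<and>
    (\<forall>\<epsilon>>0. U \<epsilon> (u\<^sub>\<epsilon> \<epsilon>) = inverse (2 * \<i> * of_real \<epsilon>) *\<^sub>C
      orth_proj (ker (shift (op_adjoint S) (- \<i> * of_real \<epsilon>))) (app St g - (\<i> * of_real \<epsilon>) *\<^sub>C g)) \<and>
    (u = g - app (SD\<inverse>) (app St g)) \<and>
    (f = app (SD\<inverse>) (app St g - orth_proj (ker (op_adjoint S)) (app St g))) \<and>
    (app T u + w = orth_proj (ker (op_adjoint S)) (app St g)) \<and>
    (eq_upto_O (\<lambda>\<epsilon>. (u\<^sub>\<epsilon> \<epsilon> - U \<epsilon> (u\<^sub>\<epsilon> \<epsilon>))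
      - app (SD\<inverse>) (app (op_adjoint S) (u\<^sub>\<epsilon> \<epsilon> - U \<epsilon> (u\<^sub>\<epsilon> \<epsilon>)))) u) \<and>
    (eq_upto_O (\<lambda>\<epsilon>. (2 * \<i> * of_real \<epsilon>) *\<^sub>C u\<^sub>\<epsilon> \<epsilon>) (app T u + w)) \<and>
    (eq_upto_O (\<lambda>\<epsilon>. (2 * \<i> * of_real \<epsilon>) *\<^sub>C U \<epsilon> (u\<^sub>\<epsilon> \<epsilon>)) (app T u + w)) \<and>
    (eq_upto_O (\<lambda>\<epsilon>. u\<^sub>\<epsilon> \<epsilon> - U \<epsilon> (u\<^sub>\<epsilon> \<epsilon>)) (app (SD\<inverse>) (app T u + w) + u)) \<and>
    (eq_upto_O (\<lambda>\<epsilon>. (\<i> * of_real \<epsilon>) *\<^sub>C u\<^sub>\<epsilon> \<epsilon> + (\<i> * of_real \<epsilon>) *\<^sub>C U \<epsilon> (u\<^sub>\<epsilon> \<epsilon>)) (app T u + w)) \<and>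
    (eq_upto_O f\<^sub>\<epsilon> f) \<and>
    (eq_upto_O (\<lambda>\<epsilon>. app (closure S) (f\<^sub>\<epsilon> \<epsilon>)) (app (closure S) f)) \<and>
    (eq_upto_O_graph St (\<lambda>\<epsilon>. u\<^sub>\<epsilon> \<epsilon> - U \<epsilon> (u\<^sub>\<epsilon> \<epsilon>)) (app (SD\<inverse>) (app T u + w) + u)) \<and>
    (eq_upto_O_graph St f\<^sub>\<epsilon> f) \<and>
    (eq_upto_O_graph (op_adjoint S) (\<lambda>\<epsilon>. u\<^sub>\<epsilon> \<epsilon> - U \<epsilon> (u\<^sub>\<epsilon> \<epsilon>)) (app (SD\<inverse>) (app T u + w) + u)) \<and>
    (eq_upto_O_graph (op_adjoint S) f\<^sub>\<epsilon> f)"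

proof -
  let ?z = "\<lambda>\<epsilon>. \<i> * complex_of_real \<epsilon>"
  let ?R = "app (SD\<inverse>)"
  let ?D = "\<lambda>\<epsilon>. u\<^sub>\<epsilon> \<epsilon> - U \<epsilon> (u\<^sub>\<epsilon> \<epsilon>)"
  define k where "k = app T u + w"
  define h where "h = app St g"
  define y where "y = app (closure S) f"
  define y\<^sub>\<epsilon> where "y\<^sub>\<epsilon> = (\<lambda>\<epsilon>. app (closure S) (f\<^sub>\<epsilon> \<epsilon>))"

  \<comment> \<open>Inclusions between the operators and boundedness of the inverse of
    \<open>SD\<close>\<close>
  have SD: "linear_operator SD" "op_adjoint SD = SD" "S \<subseteq> SD" "self_adjoint SD"
    and invSD: "single_valued (SD\<inverse>)" "Domain (SD\<inverse>) = UNIV" "bounded_operator (SD\<inverse>)"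
    using assms(6) by (auto simp: distinguished_extension_def self_adjoint_in_def)
  have St: "linear_operator St" "op_adjoint St = St"
    using assms(7) by (auto simp: self_adjoint_in_def)
  have linS: "linear_operator (op_adjoint S)"
    using assms(1) by (rule linear_op_adjoint)
  have sv: "single_valued St" "single_valued SD" "single_valued (op_adjoint S)"
    using SD(1) St(1) linS by (auto simp: linear_operator_def)
  have cl: "closure S \<subseteq> St" "closure S \<subseteq> SD" "closure S \<subseteq> op_adjoint (op_adjoint S)"
    using closed_op_adjoint[of St] closed_op_adjoint[of SD] closed_op_adjoint[of "op_adjoint S"]
      SD St assms(8) subset_op_adjoint_op_adjoint[of S] by (simp_all add: closure_minimal)
  have StS: "St \<subseteq> op_adjoint S"
    using op_adjoint_antimono[OF assms(8)] St by simp
  have svS: "single_valued (closure S)"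
    using single_valued_subset[OF cl(1)] sv by blast
  have R: "(?R x, x) \<in> SD" for x
    using app_in[OF invSD(1), of x] invSD(2) by simp
  have R_eq: "?R b = a" if "(a, b) \<in> SD" for a b
    using that by (intro app_eqI[OF invSD(1)]) simp
  have R_diff: "?R a - ?R b = ?R (a - b)" for a b
    by (rule R_eq[symmetric]) (rule linear_operator_diff[OF SD(1) R R])
  obtain C where C: "0 \<le> C" "\<And>a b. (a, b) \<in> SD \<Longrightarrow> norm a \<le> C * norm b"
  proof -
    obtain c where c: "\<And>a b. (a, b) \<in> SD \<Longrightarrow> norm a \<le> c * norm b"
      using invSD(3) by (auto simp: bounded_operator_def)
    \<comment> \<open>A constant witnessing boundedness may be negative; the absolute value makes it
      safe to multiply inequalities by \<open>C\<close>.\<close>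
    have "norm a \<le> \<bar>c\<bar> * norm b" if "(a, b) \<in> SD" for a b
      using c[OF that] mult_right_mono[OF abs_ge_self[of c], of "norm b"] by simp
    then show thesis using that[of "\<bar>c\<bar>"] by simp
  qed

  \<comment> \<open>The two decompositions of \<open>g\<close> and the action of \<open>St\<close>
    on them\<close>
  have fS: "(f, y) \<in> closure S"
    unfolding y_def by (rule app_in[OF svS assms(12)])
  have feS: "(f\<^sub>\<epsilon> \<epsilon>, y\<^sub>\<epsilon> \<epsilon>) \<in> closure S" if "\<epsilon> > 0" for \<epsilon>
    unfolding y\<^sub>\<epsilon>_def using app_in[OF svS] assms(16) that by blast
  have kvb: "closure (Domain T) \<subseteq> ker (op_adjoint S)" "self_adjoint_in (closure (Domain T)) T"
    "app St (f + ?R (app T u + w) + u) = app (closure S) f + app T u + w"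
    using assms(10,12,13,14) unfolding kvb_parameter_def Let_def by blast+
  have "(u, app T u) \<in> T"
    using kvb(2) assms(13) by (intro app_in) (auto simp: self_adjoint_in_def linear_operator_def)
  \<comment> \<open>\<open>T\<close> acts inside the closure of its domain, which is contained in
    this kernel.\<close>
  then have "app T u \<in> ker (op_adjoint S)"
    using kvb(1,2) by (auto simp: self_adjoint_in_def)
  then have k: "k \<in> ker (op_adjoint S)"
    unfolding k_def using assms(14) complex_vector.subspace_add[OF csubspace_ker[OF linS]] by blast
  then have kS: "(k, 0) \<in> op_adjoint S" by (simp add: ker_def)
  have h0: "h = y + k"
    using kvb(3) assms(15) by (simp add: h_def y_def k_def add.assoc)

  have vN: "(u\<^sub>\<epsilon> \<epsilon>, ?z \<epsilon> *\<^sub>C u\<^sub>\<epsilon> \<epsilon>) \<in> op_adjoint S" if "\<epsilon> > 0" for \<epsilon>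
    using assms(17) that by (simp add: mem_ker_shift)
  have UN: "(U \<epsilon> (u\<^sub>\<epsilon> \<epsilon>), - ?z \<epsilon> *\<^sub>C U \<epsilon> (u\<^sub>\<epsilon> \<epsilon>)) \<in> op_adjoint S"
    and h1: "h = y\<^sub>\<epsilon> \<epsilon> + ?z \<epsilon> *\<^sub>C u\<^sub>\<epsilon> \<epsilon> + ?z \<epsilon> *\<^sub>C U \<epsilon> (u\<^sub>\<epsilon> \<epsilon>)" if "\<epsilon> > 0" for \<epsilon>
  proof -
    have vn: "von_neumann_parameter S St \<epsilon> (U \<epsilon>)"
      and u: "u\<^sub>\<epsilon> \<epsilon> \<in> ker (shift (op_adjoint S) (?z \<epsilon>))"
      and fe: "f\<^sub>\<epsilon> \<epsilon> \<in> Domain (closure S)" and g: "g = f\<^sub>\<epsilon> \<epsilon> + u\<^sub>\<epsilon> \<epsilon> - U \<epsilon> (u\<^sub>\<epsilon> \<epsilon>)"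
      using assms(9,16-18) that by auto
    have "U \<epsilon> (u\<^sub>\<epsilon> \<epsilon>) \<in> ker (shift (op_adjoint S) (- \<i> * of_real \<epsilon>))"
      using vn u by (auto simp: von_neumann_parameter_def unitary_between_def Let_def)
    then show "(U \<epsilon> (u\<^sub>\<epsilon> \<epsilon>), - ?z \<epsilon> *\<^sub>C U \<epsilon> (u\<^sub>\<epsilon> \<epsilon>)) \<in> op_adjoint S"
      by (simp add: mem_ker_shift)
    show "h = y\<^sub>\<epsilon> \<epsilon> + ?z \<epsilon> *\<^sub>C u\<^sub>\<epsilon> \<epsilon> + ?z \<epsilon> *\<^sub>C U \<epsilon> (u\<^sub>\<epsilon> \<epsilon>)"
      using vn u fe unfolding von_neumann_parameter_def Let_def h_def y\<^sub>\<epsilon>_def g by blast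
  qed
  have D_eq: "?D \<epsilon> = g - f\<^sub>\<epsilon> \<epsilon>" if "\<epsilon> > 0" for \<epsilon>
    using assms(18) that by (auto simp: algebra_simps)
  have two: "(2 * \<i> * of_real \<epsilon>) *\<^sub>C x = ?z \<epsilon> *\<^sub>C x + ?z \<epsilon> *\<^sub>C x" for \<epsilon> and x :: 'a
    by (simp add: scaleC_add_left[symmetric])
  \<comment> \<open>One \<open>?z \<epsilon>\<close> comes from the action of \<open>St\<close>, the
    other from multiplying \<open>g\<close>. With the plus sign the terms in
    \<open>U \<epsilon>\<close> cancel, with the minus sign those in
    \<open>u\<^sub>\<epsilon>\<close>.\<close>
  have plus: "h + ?z \<epsilon> *\<^sub>C g = y\<^sub>\<epsilon> \<epsilon> + ?z \<epsilon> *\<^sub>C f\<^sub>\<epsilon> \<epsilon> + (2 * \<i> * of_real \<epsilon>) *\<^sub>C u\<^sub>\<epsilon> \<epsilon>"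
    and minus: "h - ?z \<epsilon> *\<^sub>C g = y\<^sub>\<epsilon> \<epsilon> - ?z \<epsilon> *\<^sub>C f\<^sub>\<epsilon> \<epsilon> + (2 * \<i> * of_real \<epsilon>) *\<^sub>C U \<epsilon> (u\<^sub>\<epsilon> \<epsilon>)"
    if "\<epsilon> > 0" for \<epsilon>
  proof -
    have "?z \<epsilon> *\<^sub>C g = ?z \<epsilon> *\<^sub>C f\<^sub>\<epsilon> \<epsilon> + ?z \<epsilon> *\<^sub>C u\<^sub>\<epsilon> \<epsilon> - ?z \<epsilon> *\<^sub>C U \<epsilon> (u\<^sub>\<epsilon> \<epsilon>)"
      using assms(18) that by (metis scaleC_add_right complex_vector.scale_right_diff_distrib)
    then show "h + ?z \<epsilon> *\<^sub>C g = y\<^sub>\<epsilon> \<epsilon> + ?z \<epsilon> *\<^sub>C f\<^sub>\<epsilon> \<epsilon> + (2 * \<i> * of_real \<epsilon>) *\<^sub>C u\<^sub>\<epsilon> \<epsilon>"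
      "h - ?z \<epsilon> *\<^sub>C g = y\<^sub>\<epsilon> \<epsilon> - ?z \<epsilon> *\<^sub>C f\<^sub>\<epsilon> \<epsilon> + (2 * \<i> * of_real \<epsilon>) *\<^sub>C U \<epsilon> (u\<^sub>\<epsilon> \<epsilon>)"
      unfolding two using h1[OF that] by simp_all
  qed

  \<comment> \<open>The exact formulas, by orthogonal projection\<close>
  have proj: "x = inverse (2 * \<i> * of_real \<epsilon>) *\<^sub>C orth_proj (ker (shift (op_adjoint S) c)) a"
    if "\<epsilon> > 0" "(x, c *\<^sub>C x) \<in> op_adjoint S"
      "a = y\<^sub>\<epsilon> \<epsilon> - cnj c *\<^sub>C f\<^sub>\<epsilon> \<epsilon> + (2 * \<i> * of_real \<epsilon>) *\<^sub>C x" for x c a \<epsilon>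
  proof -
    let ?N = "ker (shift (op_adjoint S) c)"
    have N: "csubspace ?N"
      by (rule csubspace_ker[OF linear_operator_shift[OF linS]])
    have "orth_proj ?N a = (2 * \<i> * of_real \<epsilon>) *\<^sub>C x"
    proof (rule orth_proj_eqI[OF N])
      show "(2 * \<i> * of_real \<epsilon>) *\<^sub>C x \<in> ?N"
        using that(2) by (intro complex_vector.subspace_scale[OF N]) (simp add: mem_ker_shift)
      have "cinner v (y\<^sub>\<epsilon> \<epsilon> - cnj c *\<^sub>C f\<^sub>\<epsilon> \<epsilon>) = 0" if "v \<in> ?N" for v
        using that cl(3) feS[OF \<open>\<epsilon> > 0\<close>]
        by (intro ker_shift_orthogonal) (auto simp: mem_ker_shift)
      then show "a - (2 * \<i> * of_real \<epsilon>) *\<^sub>C x \<in> corth_compl ?N"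
        using that(3) by (simp add: corth_compl_def)
    qed
    moreover have "inverse (2 * \<i> * complex_of_real \<epsilon>) * (2 * \<i> * complex_of_real \<epsilon>) = 1"
      using that(1) by (intro left_inverse) simp
    ultimately show ?thesis by (simp only: scaleC_scaleC complex_vector.scale_one)
  qed
  \<comment> \<open>\<open>proj\<close> is applied with \<open>c = ?z \<epsilon>\<close> here and
    with its negative next; in both cases \<open>cnj c = - c\<close> matches the sign in
    \<open>plus\<close> or \<open>minus\<close>.\<close>
  have 1: "u\<^sub>\<epsilon> \<epsilon> = inverse (2 * \<i> * of_real \<epsilon>) *\<^sub>C
      orth_proj (ker (shift (op_adjoint S) (\<i> * of_real \<epsilon>))) (app St g + (\<i> * of_real \<epsilon>) *\<^sub>C g)"
    if "\<epsilon> > 0" for \<epsilon>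
    using that vN[OF that] plus[OF that] by (intro proj) (simp_all add: h_def)
  have 2: "U \<epsilon> (u\<^sub>\<epsilon> \<epsilon>) = inverse (2 * \<i> * of_real \<epsilon>) *\<^sub>C
      orth_proj (ker (shift (op_adjoint S) (- \<i> * of_real \<epsilon>))) (app St g - (\<i> * of_real \<epsilon>) *\<^sub>C g)"
    if "\<epsilon> > 0" for \<epsilon>
    using that UN[OF that] minus[OF that] by (intro proj) (simp_all add: h_def)
  have Ry: "?R y = f" using R_eq fS cl(2) by blast
  have P: "orth_proj (ker (op_adjoint S)) h = k"
  proof (rule orth_proj_eqI[OF csubspace_ker[OF linS] k])
    have "cinner v y = 0" if "(v, 0) \<in> op_adjoint S" for v
      using ker_shift_orthogonal[of f y S v 0] cl(3) fS that by auto
    then show "h - k \<in> corth_compl (ker (op_adjoint S))"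
      using h0 by (simp add: corth_compl_def ker_def)
  qed
  have 4: "f = ?R (h - orth_proj (ker (op_adjoint S)) h)"
    unfolding P using h0 Ry by simp
  have g: "g = f + ?R k + u" using assms(15) by (simp add: k_def)
  \<comment> \<open>Inverting \<open>SD\<close> on \<open>h = y + k\<close> gives
    \<open>?R h = f + ?R k\<close>, which is \<open>g - u\<close>.\<close>
  have 3: "u = g - ?R h"
    using R_diff[of h k] h0 Ry g by (simp add: algebra_simps)

  \<comment> \<open>Asymptotics in the norm of the Hilbert space\<close>
  define B where "B = norm h + norm g"
  define M where "M = C * B + C * B + norm g"
  have est: "norm (y - y\<^sub>\<epsilon> \<epsilon>) \<le> M * \<epsilon>" "norm (f - f\<^sub>\<epsilon> \<epsilon>) \<le> C * M * \<epsilon>"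
    "norm (k - (2 * \<i> * of_real \<epsilon>) *\<^sub>C u\<^sub>\<epsilon> \<epsilon>) \<le> (M + C * B) * \<epsilon>" if "0 < \<epsilon>" "\<epsilon> \<le> 1" for \<epsilon>
  proof -
    have v: "((2 * \<i> * of_real \<epsilon>) *\<^sub>C u\<^sub>\<epsilon> \<epsilon>, ?z \<epsilon> *\<^sub>C (2 * \<i> * of_real \<epsilon>) *\<^sub>C u\<^sub>\<epsilon> \<epsilon>) \<in> op_adjoint S"
      using linear_operator_scaleC[OF linS vN[OF that(1)], of "2 * ?z \<epsilon>"]
      by (simp add: mult_ac)
    show "norm (y - y\<^sub>\<epsilon> \<epsilon>) \<le> M * \<epsilon>" "norm (f - f\<^sub>\<epsilon> \<epsilon>) \<le> C * M * \<epsilon>"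
      "norm (k - (2 * \<i> * of_real \<epsilon>) *\<^sub>C u\<^sub>\<epsilon> \<epsilon>) \<le> (M + C * B) * \<epsilon>"
      using deficiency_estimate[OF assms(1) SD(3,4) R C(2,1) fS feS[OF that(1)] kS v h0 plus[OF that(1)] that]
      by (simp_all add: M_def B_def)
  qed
  have lim: "?R k + u = g - f" using g by (simp add: algebra_simps)
  have D_diff: "?D \<epsilon> - (?R k + u) = f - f\<^sub>\<epsilon> \<epsilon>" if "\<epsilon> > 0" for \<epsilon>
    using D_eq[OF that] lim by simp
  have mid: "?z \<epsilon> *\<^sub>C u\<^sub>\<epsilon> \<epsilon> + ?z \<epsilon> *\<^sub>C U \<epsilon> (u\<^sub>\<epsilon> \<epsilon>) = k + (y - y\<^sub>\<epsilon> \<epsilon>)" if "\<epsilon> > 0" for \<epsilon>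
    using h1[OF that] h0 by (simp add: algebra_simps)
  \<comment> \<open>The remainder is exactly zero: the adjoint of \<open>S\<close> maps
    \<open>?D \<epsilon>\<close> to \<open>k + (y - y\<^sub>\<epsilon> \<epsilon>)\<close>, and the
    inverse of \<open>SD\<close> maps this to
    \<open>?R k + (f - f\<^sub>\<epsilon> \<epsilon>)\<close>, which is
    \<open>?D \<epsilon> - u\<close>.\<close>
  have 6: "eq_upto_O (\<lambda>\<epsilon>. ?D \<epsilon> - ?R (app (op_adjoint S) (?D \<epsilon>))) u"
  proof (rule eq_upto_OI)
    fix \<epsilon> :: real assume \<epsilon>: "0 < \<epsilon>" "\<epsilon> \<le> 1"
    have "(?D \<epsilon>, ?z \<epsilon> *\<^sub>C u\<^sub>\<epsilon> \<epsilon> - - ?z \<epsilon> *\<^sub>C U \<epsilon> (u\<^sub>\<epsilon> \<epsilon>)) \<in> op_adjoint S"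
      by (rule linear_operator_diff[OF linS vN UN]) (fact \<epsilon>)+
    then have "app (op_adjoint S) (?D \<epsilon>) = k + (y - y\<^sub>\<epsilon> \<epsilon>)"
      using app_eqI[OF sv(3)] mid[OF \<epsilon>(1)] by simp
    moreover have "?R (k + (y - y\<^sub>\<epsilon> \<epsilon>)) = ?R k + (f - f\<^sub>\<epsilon> \<epsilon>)"
      using fS feS[OF \<epsilon>(1)] cl(2)
      by (intro R_eq linear_operator_add[OF SD(1)] linear_operator_diff[OF SD(1)] R) auto
    ultimately have "?D \<epsilon> - ?R (app (op_adjoint S) (?D \<epsilon>)) - u
        = (?D \<epsilon> - (?R k + u)) - (f - f\<^sub>\<epsilon> \<epsilon>)"
      by simp
    then have "?D \<epsilon> - ?R (app (op_adjoint S) (?D \<epsilon>)) - u = 0"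
      unfolding D_diff[OF \<epsilon>(1)] by simp
    then show "norm (?D \<epsilon> - ?R (app (op_adjoint S) (?D \<epsilon>)) - u) \<le> 0 * \<epsilon>" by simp
  qed
  have 7: "eq_upto_O (\<lambda>\<epsilon>. (2 * \<i> * of_real \<epsilon>) *\<^sub>C u\<^sub>\<epsilon> \<epsilon>) k"
    using est(3) by (intro eq_upto_OI) (simp add: norm_minus_commute)
  have 8: "eq_upto_O (\<lambda>\<epsilon>. (2 * \<i> * of_real \<epsilon>) *\<^sub>C U \<epsilon> (u\<^sub>\<epsilon> \<epsilon>)) k"
  proof (rule eq_upto_OI)
    fix \<epsilon> :: real assume \<epsilon>: "0 < \<epsilon>" "\<epsilon> \<le> 1"
    have y: "y - y\<^sub>\<epsilon> \<epsilon> = ?z \<epsilon> *\<^sub>C u\<^sub>\<epsilon> \<epsilon> + ?z \<epsilon> *\<^sub>C U \<epsilon> (u\<^sub>\<epsilon> \<epsilon>) - k"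
      using mid[OF \<epsilon>(1)] by simp
    \<comment> \<open>By \<open>mid\<close> the mean of the two vectors
      \<open>2 \<i> \<epsilon> u\<^sub>\<epsilon>\<close> and
      \<open>2 \<i> \<epsilon> U u\<^sub>\<epsilon>\<close> is
      \<open>k + (y - y\<^sub>\<epsilon> \<epsilon>)\<close>, so the estimate for the first
      transfers to the second.\<close>
    have "(2 * \<i> * of_real \<epsilon>) *\<^sub>C U \<epsilon> (u\<^sub>\<epsilon> \<epsilon>) - k =
        2 *\<^sub>R (y - y\<^sub>\<epsilon> \<epsilon>) + (k - (2 * \<i> * of_real \<epsilon>) *\<^sub>C u\<^sub>\<epsilon> \<epsilon>)"
      unfolding two y by (simp add: scaleR_2 algebra_simps)
    then have "norm ((2 * \<i> * of_real \<epsilon>) *\<^sub>C U \<epsilon> (u\<^sub>\<epsilon> \<epsilon>) - k) \<le>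
        2 * norm (y - y\<^sub>\<epsilon> \<epsilon>) + norm (k - (2 * \<i> * of_real \<epsilon>) *\<^sub>C u\<^sub>\<epsilon> \<epsilon>)"
      by (metis norm_triangle_ineq norm_scaleR abs_numeral)
    then show "norm ((2 * \<i> * of_real \<epsilon>) *\<^sub>C U \<epsilon> (u\<^sub>\<epsilon> \<epsilon>) - k) \<le> (2 * M + (M + C * B)) * \<epsilon>"
      using est[OF \<epsilon>] by (simp add: distrib_right)
  qed
  have 9: "eq_upto_O ?D (?R k + u)"
    using est(2) D_diff by (intro eq_upto_OI) simp
  have 10: "eq_upto_O (\<lambda>\<epsilon>. ?z \<epsilon> *\<^sub>C u\<^sub>\<epsilon> \<epsilon> + ?z \<epsilon> *\<^sub>C U \<epsilon> (u\<^sub>\<epsilon> \<epsilon>)) k"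
    using est(1) mid by (intro eq_upto_OI) simp
  have 11: "eq_upto_O f\<^sub>\<epsilon> f"
    using est(2) by (intro eq_upto_OI) (simp add: norm_minus_commute)
  have 12: "eq_upto_O y\<^sub>\<epsilon> y"
    using est(1) by (intro eq_upto_OI) (simp add: norm_minus_commute)

  \<comment> \<open>Asymptotics in the graph norms\<close>
  have diff: "(f - f\<^sub>\<epsilon> \<epsilon>, y - y\<^sub>\<epsilon> \<epsilon>) \<in> St" "(f\<^sub>\<epsilon> \<epsilon> - f, y\<^sub>\<epsilon> \<epsilon> - y) \<in> St" if "\<epsilon> > 0" for \<epsilon>
    using fS feS[OF that] cl(1) by (auto intro!: linear_operator_diff[OF St(1)])
  \<comment> \<open>Both remainders are \<open>f - f\<^sub>\<epsilon> \<epsilon>\<close> up to sign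
    and lie in the domain of \<open>St\<close>, so one argument serves every single-valued extension
    of \<open>St\<close>, in particular the adjoint of \<open>S\<close>.\<close>
  have graph: "eq_upto_O_graph A ?D (?R k + u)" "eq_upto_O_graph A f\<^sub>\<epsilon> f"
    if "single_valued A" "St \<subseteq> A" for A
  proof -
    show "eq_upto_O_graph A ?D (?R k + u)"
      by (rule eq_upto_O_graphI[OF that(1), where y = "\<lambda>\<epsilon>. y - y\<^sub>\<epsilon> \<epsilon>"])
        (use that(2) diff est(1,2) D_diff in auto)
    show "eq_upto_O_graph A f\<^sub>\<epsilon> f"
      by (rule eq_upto_O_graphI[OF that(1), where y = "\<lambda>\<epsilon>. y\<^sub>\<epsilon> \<epsilon> - y"])
        (use that(2) diff est(1,2) in \<open>auto simp: norm_minus_commute\<close>)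
  qed
  show ?thesis
    using 1 2 3 4 P 6 7 8 9 10 11 12 graph[OF sv(1) order_refl] graph[OF sv(3) StS]
    unfolding h_def k_def y_def y\<^sub>\<epsilon>_def by (intro conjI allI impI) simp_all
qed

end
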